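(* Let $p>3$ be a prime, $x\in\mathbb{Z}_p$, $x\not\equiv 0,-1,-\frac13\pmod p$ and $\left(\frac{9x^2+14x+9}{p}\right)=1$. Then $$\sum_{k=0}^{p-1}\binom{2k}{k}\left(\frac{x}{9x^2+14x+9}\right)^k f_k\equiv \sum_{k=0}^{p-1}\binom{2k}{k}^2\binom{4k}{2k}\left(\frac{x}{9(1+3x)^4}\right)^k\pmod p.$$
   Context: $\mathbb{Z}_p$ denotes the set of rational numbers whose denominator is not divisible by $p$; congruences modulo $p$ are taken in this ring. $\left(\frac{a}{p}\right)$ is the Legendre symbol, which for $a\in\mathbb{Z}_p$ is the Legendre symbol of the residue of $a$ modulo $p$. The Franel numbers are $f_n=\sum_{k=0}^n\binom{n}{k}^3$ for $n=0,1,2,\ldots$. *)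

theory Defs
  imports "HOL-Number_Theory.Number_Theory"
begin

text \<open>The rational numbers whose denominator (in lowest terms) is not divisible by \<open>p\<close>.\<close>

definition zp :: "nat \<Rightarrow> rat set" where
  "zp p = {x. \<not> int p dvd snd (quotient_of x)}"

text \<open>Congruence modulo \<open>p\<close> in the ring \<open>zp p\<close>, including membership of both sides. Taking the
  witness from \<open>zp p\<close> is essential: in the field \<^typ>\<open>rat\<close> every number is divisible by \<open>p\<close>.\<close>

definition zp_cong :: "nat \<Rightarrow> rat \<Rightarrow> rat \<Rightarrow> bool" where
  "zp_cong p a b \<longleftrightarrow> a \<in> zp p \<and> b \<in> zp p \<and> (\<exists>c\<in>zp p. a - b = of_nat p * c)"

definition zp_residue :: "nat \<Rightarrow> rat \<Rightarrow> int" where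
  "zp_residue p a = (THE r. 0 \<le> r \<and> r < int p \<and> zp_cong p a (of_int r))"

lemma zp_residue_ex1:
  "prime p \<Longrightarrow> x \<in> zp p \<Longrightarrow> \<exists>!r. 0 \<le> r \<and> r < int p \<and> zp_cong p x (of_int r)"
proof -
  assume p: "prime p" and x: "x \<in> zp p"
  obtain a b where ab: "quotient_of x = (a,b)" by force
  have b: "b > 0" "coprime a b" "x = of_int a / of_int b"
    using ab quotient_of_denom_pos quotient_of_coprime quotient_of_div by auto
  have nd: "\<not> int p dvd b" using x ab by (simp add: zp_def)
  have pp: "prime (int p)" using p by simp
  have I: "of_int r \<in> zp p" for r using p by (auto simp: zp_def prime_nat_iff)
  have key: "zp_cong p x (of_int r) \<longleftrightarrow> int p dvd a - r * b" for r
  proof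
    assume "zp_cong p x (of_int r)"
    then obtain c where c: "c \<in> zp p" "x - of_int r = of_nat p * c" by (auto simp: zp_cong_def)
    obtain u v where uv: "quotient_of c = (u,v)" by force
    have v: "v > 0" "c = of_int u / of_int v" "\<not> int p dvd v"
      using uv quotient_of_denom_pos quotient_of_div c by (auto simp: zp_def)
    have "(of_int ((a - r*b) * v) :: rat) = of_int (int p * u * b)"
      using c v b by (simp add: field_simps)
    then have "(a - r*b) * v = int p * u * b" by (simp only: of_int_eq_iff)
    then have "int p dvd (a - r*b) * v" by simp
    then show "int p dvd a - r*b" using v pp prime_dvd_mult_iff by blast
  next
    assume "int p dvd a - r*b"
    then obtain k where k: "a - r*b = int p * k" by auto
    have e: "x - of_int r = of_nat p * (of_int k / of_int b)"
    proof -
      have "(of_int (a - r*b) :: rat) = of_int (int p * k)" using k by simp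
      then show ?thesis using b by (simp add: field_simps)
    qed
    obtain u v where uv: "quotient_of (of_int k / of_int b) = (u,v)" by force
    have v: "v > 0" "coprime u v" "(of_int k / of_int b :: rat) = of_int u / of_int v"
      using uv quotient_of_denom_pos quotient_of_coprime quotient_of_div by auto
    have "(of_int (k * v) :: rat) = of_int (u * b)" using v b by (simp add: field_simps)
    then have "k * v = u * b" by (simp only: of_int_eq_iff)
    then have "v dvd b" using v(2) by (metis coprime_commute coprime_dvd_mult_right_iff dvd_triv_right)
    then have "of_int k / of_int b \<in> zp p" using nd uv dvd_trans by (auto simp: zp_def)
    then show "zp_cong p x (of_int r)" using e x I unfolding zp_cong_def by blast
  qed
  have cb: "coprime b (int p)" using prime_imp_coprime[OF pp nd] coprime_commute by blast
  then obtain i where i: "[b * i = 1] (mod int p)" using cong_solve_coprime_int by blast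
  have "int p dvd a - ((a*i) mod int p) * b"
  proof -
    have "[((a*i) mod int p) * b = (a*i)*b] (mod int p)" by (simp add: cong_def mod_mult_left_eq)
    also have "(a*i)*b = a*(b*i)" by simp
    also have "[a*(b*i) = a*1] (mod int p)" using i cong_scalar_left by blast
    finally show ?thesis by (simp add: cong_iff_dvd_diff dvd_diff_commute)
  qed
  moreover have "0 \<le> (a*i) mod int p" "(a*i) mod int p < int p" using p prime_gt_0_nat by auto
  moreover have "r = s" if "0\<le>r" "r<int p" "0\<le>s" "s<int p" "int p dvd a - r*b" "int p dvd a - s*b" for r s
  proof -
    have "int p dvd (a - r*b) - (a - s*b)" using that(5,6) by (rule dvd_diff)
    then have "int p dvd (s - r)*b" by (simp add: algebra_simps)
    then have "int p dvd s - r" using nd pp prime_dvd_mult_iff by blast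
    then have "[s = r] (mod int p)" by (simp add: cong_iff_dvd_diff)
    then show ?thesis using that by (simp add: cong_def)
  qed
  ultimately show ?thesis unfolding key by blast
qed

text \<open>Meaningful for prime \<open>p\<close> and \<open>a \<in> zp p\<close> only, where the residue exists and is unique.\<close>

definition zp_Legendre :: "rat \<Rightarrow> nat \<Rightarrow> int" where
  "zp_Legendre a p = Legendre (zp_residue p a) (int p)"

definition franel :: "nat \<Rightarrow> nat" where
  "franel n = (\<Sum>k=0..n. (n choose k) ^ 3)"

end

theory Submission
  imports Defs
begin

text \<open>Both sides are congruent modulo \<open>p\<close> to the same polynomial in \<open>x\<close>, namely
\<open>\<Sum>n<p. u n * (x / 9) ^ n\<close>, where \<open>u n\<close> are the Almkvist--Zudilin numbers. The point is to turn each
side, a linear combination of powers of a rational function of \<open>x\<close>, into a polynomial of degree below \<open>p\<close>, and to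
recognise the coefficients.

Right-hand side. For \<open>k < p\<close> the weight \<open>(4 k)! / k! ^ 4\<close> is divisible by \<open>p\<close> once \<open>4 k \<ge> p\<close>, and for smaller \<open>k\<close>
Fermat's theorem turns \<open>(1 + 3 x) ^ (- 4 k)\<close> into \<open>(1 + 3 x) ^ (p - 1 - 4 k)\<close>. Expanding this power with
\<open>C(p - 1 - r, i) \<equiv> (- 1) ^ i * C(r + i, i)\<close> yields the coefficients
\<open>u n = (\<Sum>k\<le>n. (n + 3 k)! / ((n - k)! k! ^ 4) * (- 27) ^ (n - k))\<close>
(lemma \<open>zp_cong_quartic_series\<close>).

Left-hand side. Put \<open>D = 9 x\<^sup>2 + 14 x + 9\<close> and \<open>p = 2 m + 1\<close>. Since \<open>C(2 k, k) \<equiv> (- 4) ^ k * C(m, k)\<close>, and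
\<open>D ^ m \<equiv> 1\<close> by Euler's criterion, the sum is congruent to the homogeneous form
\<open>\<Sum>k\<le>m. C(m, k) * f k * (- 4 x) ^ k * D ^ (m - k)\<close>. Because \<open>D = 9 (1 + x)\<^sup>2 - 4 x\<close>, passing to the variable
\<open>9 (1 + x)\<^sup>2\<close> replaces the Franel numbers \<open>f\<close> by their binomial transform, which is the sequence of
honeycomb numbers \<open>g n = (\<Sum>k\<le>n. C(n, k)\<^sup>2 * C(2 k, k))\<close>. Now \<open>D\<close> has become a constant times a square, so
the expansion used before applies again and gives the coefficients
\<open>\<Sum>j\<le>n. C(n, j) * C(n + j, j) * (- 9) ^ (n - j) * g j\<close> (lemma \<open>zp_cong_franel_series\<close>).

That the two formulas for the coefficients agree is an identity between rational numbers. Both sequences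
satisfy the Almkvist--Zudilin recurrence
\<open>(n + 1)\<^sup>3 * u (n + 1) + (2 n + 1) * (7 n\<^sup>2 + 7 n + 3) * u n + 81 * n\<^sup>3 * u (n - 1) = 0\<close>, which is proved for each by
creative telescoping; the sum over \<open>g\<close> uses in addition the recurrence of \<open>g\<close>, itself proved by creative
telescoping.\<close>

section \<open>The honeycomb numbers as binomial transform of the Franel numbers\<close>

text \<open>These numbers count the closed walks of length \<open>2 n\<close> on the honeycomb lattice.\<close>

definition honeycomb :: "nat \<Rightarrow> nat" where
  "honeycomb n = (\<Sum>k\<le>n. (n choose k)\<^sup>2 * ((2 * k) choose k))"

text \<open>One factor \<open>C(k, a)\<close> of the cube is split by Vandermonde's identity as \<open>\<Sum>c. C(a, c) * C(k - a, c)\<close>.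
Multiplied by a second factor, the summand becomes \<open>C(k, c) * C(k - c, c) * C(k - 2 c, a - c)\<close>,
so that the sum over \<open>a\<close> of the product with the third factor is again a Vandermonde sum. Finally
\<open>i = k - c\<close>.\<close>

lemma franel_conv_central:
  "franel k = (\<Sum>i\<le>k. (k choose i) * (i choose (k - i)) * ((2 * i) choose i))"
proof -
  have sq: "(k choose a) = (\<Sum>c\<le>k. (a choose c) * ((k - a) choose c))" if "a \<le> k" for a
  proof -
    have "(k choose a) = ((a + (k - a)) choose (k - a))"
      using that binomial_symmetric[OF that] by simp
    also have "\<dots> = (\<Sum>c\<le>k - a. (a choose c) * ((k - a) choose (k - a - c)))"
      by (rule vandermonde[symmetric])
    also have "\<dots> = (\<Sum>c\<le>k - a. (a choose c) * ((k - a) choose c))"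
      by (intro sum.cong refl arg_cong2[where f = "(*)"]) (simp only: atMost_iff binomial_symmetric[symmetric])
    also have "\<dots> = (\<Sum>c\<le>k. (a choose c) * ((k - a) choose c))"
      by (intro sum.mono_neutral_left) auto
    finally show ?thesis .
  qed
  have mult: "(k choose a) * ((a choose c) * ((k - a) choose c))
      = (if c \<le> a then (k choose c) * ((k - c) choose c) * ((k - 2 * c) choose (a - c)) else 0)"
    if "a \<le> k" for a c
  proof (cases "c \<le> a")
    case True
    have "(k choose a) * (a choose c) = (k choose c) * ((k - c) choose (a - c))"
      using choose_mult[OF True that] by simp
    moreover have "((k - c) choose (a - c)) * ((k - a) choose c) = ((k - c) choose c) * ((k - 2 * c) choose (a - c))"
    proof (cases "c \<le> k - a")
      case c: True
      have "((k - c) choose (k - a)) * ((k - a) choose c) = ((k - c) choose c) * ((k - c - c) choose (k - a - c))"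
        using True that c by (intro choose_mult) auto
      moreover have "((k - c) choose (k - a)) = ((k - c) choose (a - c))"
        using True that binomial_symmetric[of "a - c" "k - c"] by simp
      moreover have "((k - c - c) choose (k - a - c)) = ((k - 2 * c) choose (a - c))"
        using True that c binomial_symmetric[of "a - c" "k - 2 * c"] by (simp add: mult_2 add.commute)
      ultimately show ?thesis by simp
    next
      case False
      then have "k - a < c" "k - 2 * c < a - c \<or> k - c < c" using that True by linarith+
      then show ?thesis by (auto simp: binomial_eq_0)
    qed
    ultimately show ?thesis using True by (metis mult.assoc)
  qed simp
  have vdm: "(\<Sum>a\<in>{c..k}. (k choose a) * ((k - 2 * c) choose (a - c))) = ((2 * (k - c)) choose (k - c))"
    if "2 * c \<le> k" for c
  proof -
    have "(\<Sum>a\<in>{c..k}. (k choose a) * ((k - 2 * c) choose (a - c)))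
        = (\<Sum>b\<le>k - c. ((k - 2 * c) choose b) * (k choose (k - c - b)))"
    proof (rule sum.reindex_bij_witness[of _ "\<lambda>b. b + c" "\<lambda>a. a - c"])
      fix a assume "a \<in> {c..k}"
      then have "k - c - (a - c) = k - a" "(k choose (k - a)) = (k choose a)"
        by (auto simp: binomial_symmetric[symmetric])
      then show "((k - 2 * c) choose (a - c)) * (k choose (k - c - (a - c))) = (k choose a) * ((k - 2 * c) choose (a - c))"
        by simp
    qed (use that in auto)
    also have "\<dots> = ((k - 2 * c + k) choose (k - c))" by (rule vandermonde)
    also have "k - 2 * c + k = 2 * (k - c)" using that by simp
    finally show ?thesis .
  qed
  have "franel k = (\<Sum>a\<le>k. (k choose a) * ((k choose a) * (k choose a)))"
    by (simp add: franel_def atMost_atLeast0 power3_eq_cube mult.assoc)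
  also have "\<dots> = (\<Sum>a\<le>k. \<Sum>c\<le>k. (k choose a) * ((k choose a) * ((a choose c) * ((k - a) choose c))))"
    by (intro sum.cong refl) (subst (3) sq, auto simp: sum_distrib_left)
  also have "\<dots> = (\<Sum>c\<le>k. \<Sum>a\<le>k. (k choose a) * ((k choose a) * ((a choose c) * ((k - a) choose c))))"
    by (rule sum.swap)
  also have "\<dots> = (\<Sum>c\<le>k. (k choose c) * ((k - c) choose c) * ((2 * (k - c)) choose (k - c)))"
  proof (intro sum.cong refl)
    fix c assume "c \<in> {..k}"
    have "(\<Sum>a\<le>k. (k choose a) * ((k choose a) * ((a choose c) * ((k - a) choose c))))
        = (\<Sum>a\<in>{c..k}. (k choose c) * ((k - c) choose c) * ((k choose a) * ((k - 2 * c) choose (a - c))))"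
      by (intro sum.mono_neutral_cong_right) (auto simp: mult)
    also have "\<dots> = (k choose c) * ((k - c) choose c) * (\<Sum>a\<in>{c..k}. (k choose a) * ((k - 2 * c) choose (a - c)))"
      by (simp add: sum_distrib_left)
    also have "\<dots> = (k choose c) * ((k - c) choose c) * ((2 * (k - c)) choose (k - c))"
      using binomial_eq_0[of "k - c" c] by (cases "2 * c \<le> k") (auto simp: vdm)
    finally show "(\<Sum>a\<le>k. (k choose a) * ((k choose a) * ((a choose c) * ((k - a) choose c)))) = \<dots>" .
  qed
  also have "\<dots> = (\<Sum>i\<le>k. (k choose i) * (i choose (k - i)) * ((2 * i) choose i))"
    by (rule sum.reindex_bij_witness[of _ "\<lambda>i. k - i" "\<lambda>c. k - c"])
       (auto simp: binomial_symmetric[symmetric])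
  finally show ?thesis .
qed

text \<open>The previous formula for the Franel numbers leaves, for each \<open>i\<close>, the inner sum
\<open>\<Sum>k. C(n - i, k - i) * C(i, k - i) = C(n, i)\<close>.\<close>

lemma binomial_transform_franel: "(\<Sum>k\<le>n. (n choose k) * franel k) = honeycomb n"
proof -
  have vdm: "(\<Sum>k\<in>{i..n}. ((n - i) choose (k - i)) * (i choose (k - i))) = (n choose i)" if "i \<le> n" for i
  proof -
    have "(\<Sum>k\<in>{i..n}. ((n - i) choose (k - i)) * (i choose (k - i)))
        = (\<Sum>b\<le>n - i. (i choose b) * ((n - i) choose (n - i - b)))"
    proof (rule sum.reindex_bij_witness[of _ "\<lambda>b. b + i" "\<lambda>k. k - i"])
      fix k assume "k \<in> {i..n}"
      then have "k - i \<le> n - i" by (intro diff_le_mono) simp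
      then have "((n - i) choose (n - i - (k - i))) = ((n - i) choose (k - i))"
        by (simp only: binomial_symmetric[symmetric])
      then show "(i choose (k - i)) * ((n - i) choose (n - i - (k - i))) = ((n - i) choose (k - i)) * (i choose (k - i))"
        by simp
    qed (use that in auto)
    also have "\<dots> = ((i + (n - i)) choose (n - i))" by (rule vandermonde)
    also have "\<dots> = (n choose i)" using that by (simp add: binomial_symmetric[symmetric])
    finally show ?thesis .
  qed
  have "(\<Sum>k\<le>n. (n choose k) * franel k)
      = (\<Sum>k\<le>n. \<Sum>i\<le>n. (n choose k) * ((k choose i) * (i choose (k - i)) * ((2 * i) choose i)))"
    unfolding franel_conv_central sum_distrib_left
    by (intro sum.cong refl sum.mono_neutral_left) auto
  also have "\<dots> = (\<Sum>i\<le>n. \<Sum>k\<le>n. (n choose k) * ((k choose i) * (i choose (k - i)) * ((2 * i) choose i)))"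
    by (rule sum.swap)
  also have "\<dots> = (\<Sum>i\<le>n. (n choose i)\<^sup>2 * ((2 * i) choose i))"
  proof (intro sum.cong refl)
    fix i assume i: "i \<in> {..n}"
    have "(\<Sum>k\<le>n. (n choose k) * ((k choose i) * (i choose (k - i)) * ((2 * i) choose i)))
       = (\<Sum>k\<in>{i..n}. (n choose i) * ((2 * i) choose i) * (((n - i) choose (k - i)) * (i choose (k - i))))"
    proof (rule sum.mono_neutral_cong_right)
      fix k assume "k \<in> {i..n}"
      then have "(n choose k) * (k choose i) = (n choose i) * ((n - i) choose (k - i))"
        by (intro choose_mult) auto
      then have "((n choose k) * (k choose i)) * ((i choose (k - i)) * ((2 * i) choose i))
          = ((n choose i) * ((n - i) choose (k - i))) * ((i choose (k - i)) * ((2 * i) choose i))"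
        by simp
      then show "(n choose k) * ((k choose i) * (i choose (k - i)) * ((2 * i) choose i)) =
         (n choose i) * ((2 * i) choose i) * (((n - i) choose (k - i)) * (i choose (k - i)))"
        by (simp only: ac_simps)
    qed auto
    also have "\<dots> = (n choose i)\<^sup>2 * ((2 * i) choose i)"
      using i by (simp add: sum_distrib_left[symmetric] vdm power2_eq_square)
    finally show "(\<Sum>k\<le>n. (n choose k) * ((k choose i) * (i choose (k - i)) * ((2 * i) choose i))) = \<dots>" .
  qed
  finally show ?thesis unfolding honeycomb_def .
qed

text \<open>With the \<open>f k\<close> regarded as the moments of a formal random variable \<open>Z\<close>, the left side is the expectation of
\<open>((y + w) + y Z) ^ m\<close> and the right side that of \<open>(y (1 + Z) + w) ^ m\<close>: replacing \<open>Z\<close> by \<open>1 + Z\<close> changes the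
moments into their binomial transform.\<close>

lemma binomial_transform_homogeneous:
  fixes y w :: "'a :: comm_semiring_1" and f :: "nat \<Rightarrow> nat"
  shows "(\<Sum>k\<le>m. of_nat (m choose k) * of_nat (f k) * y ^ k * (y + w) ^ (m - k))
       = (\<Sum>j\<le>m. of_nat (m choose j) * of_nat (\<Sum>k\<le>j. (j choose k) * f k) * y ^ j * w ^ (m - j))"
proof -
  have "(\<Sum>j\<le>m. of_nat (m choose j) * of_nat (\<Sum>k\<le>j. (j choose k) * f k) * y ^ j * w ^ (m - j))
      = (\<Sum>j\<le>m. \<Sum>k\<le>m. of_nat ((m choose j) * (j choose k)) * of_nat (f k) * y ^ j * w ^ (m - j))"
  proof (intro sum.cong refl)
    fix j assume "j \<in> {..m}"
    then have "(\<Sum>k\<le>j. (j choose k) * f k) = (\<Sum>k\<le>m. (j choose k) * f k)"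
      by (intro sum.mono_neutral_left) auto
    then show "of_nat (m choose j) * of_nat (\<Sum>k\<le>j. (j choose k) * f k) * y ^ j * w ^ (m - j)
      = (\<Sum>k\<le>m. of_nat ((m choose j) * (j choose k)) * of_nat (f k) * y ^ j * w ^ (m - j))"
      by (simp add: sum_distrib_left sum_distrib_right mult.assoc)
  qed
  also have "\<dots> = (\<Sum>k\<le>m. \<Sum>j\<le>m. of_nat ((m choose j) * (j choose k)) * of_nat (f k) * y ^ j * w ^ (m - j))"
    by (rule sum.swap)
  also have "\<dots> = (\<Sum>k\<le>m. of_nat (m choose k) * of_nat (f k) * y ^ k * (y + w) ^ (m - k))"
  proof (intro sum.cong refl)
    fix k assume k: "k \<in> {..m}"
    have "(\<Sum>j\<le>m. of_nat ((m choose j) * (j choose k)) * of_nat (f k) * y ^ j * w ^ (m - j))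
       = (\<Sum>i\<le>m - k. of_nat (m choose k) * of_nat (f k) * y ^ k * (of_nat ((m - k) choose i) * y ^ i * w ^ (m - k - i)))"
    proof -
      have "(\<Sum>j\<le>m. of_nat ((m choose j) * (j choose k)) * of_nat (f k) * y ^ j * w ^ (m - j))
          = (\<Sum>j\<in>{k..m}. of_nat ((m choose j) * (j choose k)) * of_nat (f k) * y ^ j * w ^ (m - j))"
        by (intro sum.mono_neutral_right) (auto simp: not_le binomial_eq_0)
      also have "\<dots> = (\<Sum>i\<le>m - k. of_nat (m choose k) * of_nat (f k) * y ^ k * (of_nat ((m - k) choose i) * y ^ i * w ^ (m - k - i)))"
      proof (rule sum.reindex_bij_witness[of _ "\<lambda>i. i + k" "\<lambda>j. j - k"])
        fix j assume j: "j \<in> {k..m}"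
        then have "(m choose j) * (j choose k) = (m choose k) * ((m - k) choose (j - k))"
          by (intro choose_mult) auto
        moreover have "y ^ j = y ^ k * y ^ (j - k)" using j by (simp flip: power_add)
        moreover have "m - k - (j - k) = m - j" using j by auto
        ultimately show "of_nat (m choose k) * of_nat (f k) * y ^ k *
            (of_nat ((m - k) choose (j - k)) * y ^ (j - k) * w ^ (m - k - (j - k)))
          = of_nat ((m choose j) * (j choose k)) * of_nat (f k) * y ^ j * w ^ (m - j)"
          by (simp add: ac_simps)
      qed (use k in auto)
      finally show ?thesis .
    qed
    also have "\<dots> = of_nat (m choose k) * of_nat (f k) * y ^ k * (y + w) ^ (m - k)"
      by (simp add: binomial_ring sum_distrib_left)
    finally show "(\<Sum>j\<le>m. of_nat ((m choose j) * (j choose k)) * of_nat (f k) * y ^ j * w ^ (m - j)) = \<dots>" .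
  qed
  finally show ?thesis by simp
qed

section \<open>Reciprocal factorials\<close>

text \<open>The convention \<open>1 / (- n)! = 0\<close> makes the contiguity relation \<open>1 / i! = (i + 1) / (i + 1)!\<close> hold for every
integer \<open>i\<close>. Hence a telescoping certificate can be checked as one polynomial identity, with no separate
treatment of the ends of the summation range.\<close>

definition recip_fact :: "int \<Rightarrow> rat" where
  "recip_fact i = (if i < 0 then 0 else 1 / fact (nat i))"

lemma recip_fact_of_nat: "recip_fact (int k) = 1 / fact k"
  by (simp add: recip_fact_def)

lemma recip_fact_step: "recip_fact i = of_int (i + 1) * recip_fact (i + 1)"
proof -
  consider "i < -1" | "i = -1" | "i \<ge> 0" by linarith
  then show ?thesis
  proof cases
    case 3
    then obtain k where "i = int k" by (metis nonneg_int_cases)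
    moreover have "nat (int k + 1) = Suc k" by simp
    moreover have "1 + rat_of_nat k \<noteq> 0" using of_nat_neq_0[of k, where 'a = rat] by simp
    moreover have "recip_fact (int k + 1) = 1 / ((1 + of_nat k) * fact k)"
      using \<open>nat (int k + 1) = Suc k\<close> by (simp add: recip_fact_def)
    ultimately show ?thesis by (simp add: recip_fact_of_nat add.commute)
  qed (auto simp: recip_fact_def)
qed

lemma recip_fact_nat_step: "recip_fact (int k) = (of_nat k + 1) * recip_fact (int (Suc k))"
  using recip_fact_step[of "int k"] by (simp add: add.commute)

lemma recip_fact_diff_steps:
  "recip_fact (int n - int k) = (of_nat n + 1 - of_nat k) * recip_fact (int n + 1 - int k)"
  "recip_fact (int n + 1 - int k) = (of_nat n + 2 - of_nat k) * recip_fact (int n + 2 - int k)"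
proof -
  have e: "int n - int k + 1 = int n + 1 - int k" "int n + 1 - int k + 1 = int n + 2 - int k"
    by simp_all
  show "recip_fact (int n - int k) = (of_nat n + 1 - of_nat k) * recip_fact (int n + 1 - int k)"
    by (subst recip_fact_step) (simp only: e of_int_diff of_int_add of_int_of_nat_eq of_int_1)
  show "recip_fact (int n + 1 - int k) = (of_nat n + 2 - of_nat k) * recip_fact (int n + 2 - int k)"
    by (subst recip_fact_step) (simp only: e of_int_diff of_int_add of_int_of_nat_eq of_int_numeral)
qed

lemma recip_fact_neg: "i < 0 \<Longrightarrow> recip_fact i = 0"
  by (simp add: recip_fact_def)

lemma recip_fact_diff: "k \<le> n \<Longrightarrow> recip_fact (int n - int k) = 1 / fact (n - k)"
  by (metis of_nat_diff recip_fact_of_nat)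

lemma sum_atMost_extend:
  fixes f :: "nat \<Rightarrow> 'a :: comm_monoid_add"
  assumes "n \<le> N" "\<And>k. n < k \<Longrightarrow> f k = 0"
  shows "sum f {..n} = sum f {..N}"
  using assms by (intro sum.mono_neutral_left) auto

lemma binomial_recip_fact:
  "of_nat (n choose k) = fact n * recip_fact (int n - int k) * recip_fact (int k)"
proof (cases "k \<le> n")
  case True
  then have "nat (int n - int k) = n - k" by simp
  then show ?thesis using True by (simp add: recip_fact_def binomial_fact field_simps)
qed (simp add: recip_fact_neg)

lemma central_binomial_fact: "of_nat ((2 * k) choose k) = (fact (2 * k) :: rat) / (fact k)\<^sup>2"
  by (simp add: binomial_fact power2_eq_square)

lemma power_diff_reciprocal: "c \<noteq> 0 \<Longrightarrow> k \<le> n \<Longrightarrow> c ^ (n - k) = c ^ n * (1 / c) ^ k" for c :: rat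
  by (simp add: power_diff power_divide)

section \<open>Two expressions for the Almkvist--Zudilin numbers\<close>

text \<open>Creative telescoping. With \<open>N = n + 1\<close>, the recurrence operator applied to the summand \<open>t\<close> equals
\<open>G (k + 1) - G k\<close>, where \<open>G\<close> is a polynomial multiple of the term \<open>b\<close>, of which \<open>t n\<close>, \<open>t (n + 1)\<close>,
\<open>t (n + 2)\<close> are polynomial multiples too. Here \<open>G 0 = 0\<close> because of the factor \<open>k ^ 3\<close>, and \<open>G k = 0\<close> for
\<open>k > n + 2\<close> because of the reciprocal factorial.\<close>

lemma honeycomb_rec:
  "(of_nat n + 2)\<^sup>2 * (of_nat (honeycomb (n + 2)) :: rat)
     = (10 * (of_nat n + 1)\<^sup>2 + 10 * (of_nat n + 1) + 3) * of_nat (honeycomb (n + 1))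
       - 9 * (of_nat n + 1)\<^sup>2 * of_nat (honeycomb n)"
proof -
  define t :: "nat \<Rightarrow> nat \<Rightarrow> rat" where
    "t m k = (fact m)\<^sup>2 * fact (2 * k) * (recip_fact (int m - int k))\<^sup>2 * recip_fact (int k) ^ 4" for m k
  define N :: rat where "N = of_nat n + 1"
  define b :: "nat \<Rightarrow> rat" where
    "b k = (fact n)\<^sup>2 * fact (2 * k) * (recip_fact (int n + 2 - int k))\<^sup>2 * recip_fact (int k) ^ 4" for k
  define G :: "nat \<Rightarrow> rat" where
    "G k = of_nat k ^ 3 * N\<^sup>2 * (3 * of_nat k - 4 * (N + 1)) * b k" for k
  define M where "M = n + 2"
  have le: "n + 2 \<le> M" "n + 1 \<le> M" "n \<le> M" by (simp_all add: M_def)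
  have hex: "of_nat (honeycomb m) = (\<Sum>k\<le>M. t m k)" if "m \<le> M" for m
  proof -
    have "of_nat (honeycomb m) = (\<Sum>k\<le>m. t m k)"
      by (simp add: honeycomb_def t_def binomial_recip_fact recip_fact_of_nat central_binomial_fact
            power2_eq_square power4_eq_xxxx field_simps)
    also have "\<dots> = (\<Sum>k\<le>M. t m k)"
      using that by (intro sum_atMost_extend) (auto simp: t_def recip_fact_neg)
    finally show ?thesis .
  qed
  have step: "(N + 1)\<^sup>2 * t (n + 2) k - (10 * N\<^sup>2 + 10 * N + 3) * t (n + 1) k + 9 * N\<^sup>2 * t n k
      = G (Suc k) - G k" for k
  proof -
    define K :: rat where "K = of_nat k"
    define R where "R = recip_fact (int n + 2 - int k)"
    define \<rho> where "\<rho> = recip_fact (int (Suc k))"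
    have \<rho>: "recip_fact (int k) = (K + 1) * \<rho>"
      unfolding \<rho>_def K_def by (rule recip_fact_nat_step)
    have R1: "recip_fact (int n + 1 - int k) = (N + 1 - K) * R"
      using recip_fact_diff_steps(2)[of n k] unfolding N_def K_def R_def by simp
    have R0: "recip_fact (int n - int k) = (N - K) * ((N + 1 - K) * R)"
      using recip_fact_diff_steps(1)[of n k] R1 unfolding N_def K_def by simp
    have f1: "fact (n + 1) = N * (fact n :: rat)"
      by (simp add: N_def)
    have f2: "fact (n + 2) = (N + 1) * N * (fact n :: rat)"
      by (simp add: N_def algebra_simps)
    have i2: "int (n + 2) - int k = int n + 2 - int k" and i1: "int (n + 1) - int k = int n + 1 - int k"
      by simp_all
    have t2: "t (n + 2) k = (N * (N + 1))\<^sup>2 * b k"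
      unfolding t_def b_def f2 i2 power_mult_distrib by (simp only: ac_simps)
    have t1: "t (n + 1) k = (N * (N + 1 - K))\<^sup>2 * b k"
      unfolding t_def b_def f1 i1 R1 R_def[symmetric] power_mult_distrib by (simp only: ac_simps)
    have t0: "t n k = ((N - K) * (N + 1 - K))\<^sup>2 * b k"
      unfolding t_def b_def R0 R_def[symmetric] power_mult_distrib by (simp only: ac_simps)
    have bS: "(K + 1) ^ 3 * b (Suc k) = 2 * (2 * K + 1) * (N + 1 - K)\<^sup>2 * b k"
    proof -
      have e: "int n + 2 - int (Suc k) = int n + 1 - int k" by simp
      have f3: "fact (2 * Suc k) = 2 * (K + 1) * (2 * K + 1) * (fact (2 * k) :: rat)"
        by (simp add: K_def algebra_simps)
      show ?thesis
        unfolding b_def e f3 R1 \<rho> R_def[symmetric] \<rho>_def[symmetric]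
        by (simp only: power2_eq_square power3_eq_cube power4_eq_xxxx ac_simps)
    qed
    have GS: "G (Suc k) = N\<^sup>2 * (3 * (K + 1) - 4 * (N + 1)) * ((K + 1) ^ 3 * b (Suc k))"
      by (simp add: G_def K_def algebra_simps)
    have Gk: "G k = K ^ 3 * N\<^sup>2 * (3 * K - 4 * (N + 1)) * b k"
      by (simp add: G_def K_def)
    show ?thesis unfolding GS Gk t2 t1 t0 bS
      by (simp add: power2_eq_square power3_eq_cube power4_eq_xxxx algebra_simps)
  qed
  have "(\<Sum>k\<le>M. (N + 1)\<^sup>2 * t (n + 2) k - (10 * N\<^sup>2 + 10 * N + 3) * t (n + 1) k + 9 * N\<^sup>2 * t n k)
      = G (Suc M) - G 0"
    unfolding step lessThan_Suc_atMost[symmetric] by (rule sum_lessThan_telescope)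
  also have "\<dots> = 0" by (simp add: G_def b_def recip_fact_neg M_def)
  finally have "(N + 1)\<^sup>2 * of_nat (honeycomb (n + 2)) - (10 * N\<^sup>2 + 10 * N + 3) * of_nat (honeycomb (n + 1))
      + 9 * N\<^sup>2 * of_nat (honeycomb n) = 0"
    by (simp only: hex[OF le(1)] hex[OF le(2)] hex[OF le(3)] sum.distrib sum_subtractf sum_distrib_left)
  then show ?thesis by (simp add: N_def algebra_simps)
qed

text \<open>The coefficients obtained from the left-hand side; the product of the two binomial coefficients is
\<open>C(n, j) * C(n + j, j)\<close>.\<close>

definition honeycomb_sum :: "nat \<Rightarrow> rat" where
  "honeycomb_sum n = (\<Sum>j\<le>n. of_nat ((2 * j) choose j) * of_nat ((n + j) choose (2 * j))
      * (-9) ^ (n - j) * of_nat (honeycomb j))"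

text \<open>The coefficients obtained from the right-hand side; the product of the binomial coefficients is
\<open>(n + 3 k)! / ((n - k)! k! ^ 4)\<close>.\<close>

definition almkvist_zudilin :: "nat \<Rightarrow> rat" where
  "almkvist_zudilin n = (\<Sum>k\<le>n. of_nat (((2 * k) choose k)\<^sup>2 * ((4 * k) choose (2 * k)))
      * of_nat ((n + 3 * k) choose (4 * k)) * (-27) ^ (n - k))"

text \<open>Creative telescoping as for the honeycomb numbers. The certificate comes from Gosper's algorithm, whose
polynomial equation has here a solution of degree 0 in \<open>k\<close>.\<close>

lemma almkvist_zudilin_rec:
  "(of_nat n + 2) ^ 3 * almkvist_zudilin (n + 2)
     = - (2 * of_nat n + 3) * (7 * (of_nat n + 1)\<^sup>2 + 7 * (of_nat n + 1) + 3) * almkvist_zudilin (n + 1)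
       - 81 * (of_nat n + 1) ^ 3 * almkvist_zudilin n"
proof -
  define t :: "nat \<Rightarrow> nat \<Rightarrow> rat" where
    "t m k = fact (m + 3 * k) * recip_fact (int m - int k) * recip_fact (int k) ^ 4
       * ((-27) ^ m * (- 1 / 27) ^ k)" for m k
  define N :: rat where "N = of_nat n + 1"
  define b :: "nat \<Rightarrow> rat" where
    "b k = fact (n + 3 * k) * recip_fact (int n + 2 - int k) * recip_fact (int k) ^ 4
       * ((-27) ^ n * (- 1 / 27) ^ k)" for k
  define G :: "nat \<Rightarrow> rat" where
    "G k = - 2916 * (4 * N + 3) * of_nat k ^ 4 * b k" for k
  define M where "M = n + 2"
  have le: "n + 2 \<le> M" "n + 1 \<le> M" "n \<le> M" by (simp_all add: M_def)
  have ext: "almkvist_zudilin m = (\<Sum>k\<le>M. t m k)" if "m \<le> M" for m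
  proof -
    have "almkvist_zudilin m = (\<Sum>k\<le>m. t m k)"
      unfolding almkvist_zudilin_def
    proof (intro sum.cong refl)
      fix k assume "k \<in> {..m}"
      then have k: "k \<le> m" by simp
      have "of_nat ((m + 3 * k) choose (4 * k)) = fact (m + 3 * k) / (fact (4 * k) * fact (m - k) :: rat)"
        using k by (subst binomial_fact) auto
      moreover have "of_nat ((4 * k) choose (2 * k)) = fact (4 * k) / ((fact (2 * k))\<^sup>2 :: rat)"
        by (subst binomial_fact) (auto simp: power2_eq_square)
      ultimately show "of_nat (((2 * k) choose k)\<^sup>2 * ((4 * k) choose (2 * k)))
          * of_nat ((m + 3 * k) choose (4 * k)) * (-27) ^ (m - k) = t m k"
        using power_diff_reciprocal[of "-27", OF _ k]
        by (simp add: t_def recip_fact_diff[OF k] recip_fact_of_nat central_binomial_fact power_divide)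
    qed
    also have "\<dots> = (\<Sum>k\<le>M. t m k)"
      using that by (intro sum_atMost_extend) (auto simp: t_def recip_fact_neg)
    finally show ?thesis .
  qed
  have step: "(N + 1) ^ 3 * t (n + 2) k + (2 * N + 1) * (7 * N\<^sup>2 + 7 * N + 3) * t (n + 1) k
      + 81 * N ^ 3 * t n k = G (Suc k) - G k" for k
  proof -
    define K :: rat where "K = of_nat k"
    define R where "R = recip_fact (int n + 2 - int k)"
    define \<rho> where "\<rho> = recip_fact (int (Suc k))"
    have \<rho>: "recip_fact (int k) = (K + 1) * \<rho>"
      unfolding \<rho>_def K_def by (rule recip_fact_nat_step)
    have R1: "recip_fact (int n + 1 - int k) = (N + 1 - K) * R"
      using recip_fact_diff_steps(2)[of n k] unfolding N_def K_def R_def by simp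
    have R0: "recip_fact (int n - int k) = (N - K) * ((N + 1 - K) * R)"
      using recip_fact_diff_steps(1)[of n k] R1 unfolding N_def K_def by simp
    have f1: "fact (n + 1 + 3 * k) = (N + 3 * K) * (fact (n + 3 * k) :: rat)"
      by (simp add: N_def K_def)
    have f2: "fact (n + 2 + 3 * k) = (N + 3 * K + 1) * (N + 3 * K) * (fact (n + 3 * k) :: rat)"
      by (simp add: N_def K_def algebra_simps)
    have f3: "fact (n + 3 * Suc k) = (N + 3 * K + 2) * (N + 3 * K + 1) * (N + 3 * K) * (fact (n + 3 * k) :: rat)"
    proof -
      have "n + 3 * Suc k = Suc (Suc (Suc (n + 3 * k)))" by simp
      then show ?thesis by (simp only: fact_Suc) (simp add: N_def K_def add.commute)
    qed
    have i2: "int (n + 2) - int k = int n + 2 - int k" and i1: "int (n + 1) - int k = int n + 1 - int k"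
      by simp_all
    have t2: "t (n + 2) k = 729 * (N + 3 * K + 1) * (N + 3 * K) * b k"
      unfolding t_def b_def f2 i2 by simp
    have t1: "t (n + 1) k = - 27 * (N + 3 * K) * (N + 1 - K) * b k"
      unfolding t_def b_def f1 i1 R1 R_def[symmetric] by (simp add: algebra_simps)
    have t0: "t n k = (N - K) * (N + 1 - K) * b k"
      unfolding t_def b_def R0 R_def[symmetric] by simp
    have bS: "(K + 1) ^ 4 * b (Suc k)
        = (N + 3 * K + 2) * (N + 3 * K + 1) * (N + 3 * K) * (N + 1 - K) * (- 1 / 27) * b k"
    proof -
      have e: "int n + 2 - int (Suc k) = int n + 1 - int k" by simp
      show ?thesis
        unfolding b_def e f3 R1 \<rho> R_def[symmetric] \<rho>_def[symmetric] power_Suc power_mult_distrib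
        by (simp only: ac_simps)
    qed
    have GS: "G (Suc k) = - 2916 * (4 * N + 3) * ((K + 1) ^ 4 * b (Suc k))"
      by (simp add: G_def K_def add.commute)
    have Gk: "G k = - 2916 * (4 * N + 3) * K ^ 4 * b k"
      by (simp add: G_def K_def)
    show ?thesis unfolding GS Gk t2 t1 t0 bS
      by (simp add: power2_eq_square power3_eq_cube power4_eq_xxxx field_simps)
  qed
  have "(\<Sum>k\<le>M. (N + 1) ^ 3 * t (n + 2) k + (2 * N + 1) * (7 * N\<^sup>2 + 7 * N + 3) * t (n + 1) k
      + 81 * N ^ 3 * t n k) = G (Suc M) - G 0"
    unfolding step lessThan_Suc_atMost[symmetric] by (rule sum_lessThan_telescope)
  also have "\<dots> = 0" by (simp add: G_def b_def recip_fact_neg M_def)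
  finally have "(N + 1) ^ 3 * almkvist_zudilin (n + 2) + (2 * N + 1) * (7 * N\<^sup>2 + 7 * N + 3) * almkvist_zudilin (n + 1)
      + 81 * N ^ 3 * almkvist_zudilin n = 0"
    by (simp only: ext[OF le(1)] ext[OF le(2)] ext[OF le(3)] sum.distrib sum_distrib_left)
  moreover have "of_nat n = N - 1" by (simp add: N_def)
  ultimately show ?thesis by (simp only:) (simp add: algebra_simps)
qed

text \<open>The summand contains the honeycomb number \<open>g j\<close>, which is not hypergeometric. The certificate
is therefore sought as a combination of \<open>g j\<close> and \<open>g (j - 1)\<close>, and \<open>g (j + 1)\<close> is eliminated by the recurrence of
\<open>g\<close>. If the coefficient of \<open>g j\<close> in \<open>G j / b j\<close> is taken to be \<open>\<alpha> * j ^ 4\<close> with \<open>\<alpha>\<close> independent of \<open>j\<close>, then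
the cancellation of \<open>g (j - 1)\<close> forces that of \<open>g (j - 1)\<close> in \<open>G j / b j\<close> to be
\<open>\<alpha> * j\<^sup>2 * (N + j) * (N + 1 - j)\<close>, and comparing the coefficients of \<open>g j\<close> gives \<open>\<alpha> = - 162 * (2 * N + 1)\<close>.\<close>

lemma honeycomb_sum_rec:
  "(of_nat n + 2) ^ 3 * honeycomb_sum (n + 2)
     = - (2 * of_nat n + 3) * (7 * (of_nat n + 1)\<^sup>2 + 7 * (of_nat n + 1) + 3) * honeycomb_sum (n + 1)
       - 81 * (of_nat n + 1) ^ 3 * honeycomb_sum n"
proof -
  define t :: "nat \<Rightarrow> nat \<Rightarrow> rat" where
    "t m j = fact (m + j) * recip_fact (int m - int j) * recip_fact (int j) ^ 2
       * ((-9) ^ m * (- 1 / 9) ^ j)" for m j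
  define g :: "nat \<Rightarrow> rat" where "g j = of_nat (honeycomb j)" for j
  define N :: rat where "N = of_nat n + 1"
  define b :: "nat \<Rightarrow> rat" where
    "b j = fact (n + j) * recip_fact (int n + 2 - int j) * recip_fact (int j) ^ 2
       * ((-9) ^ n * (- 1 / 9) ^ j)" for j
  define G :: "nat \<Rightarrow> rat" where
    "G j = - 162 * (2 * N + 1) * of_nat j ^ 2 * b j
       * (of_nat j ^ 2 * g j + (N + of_nat j) * (N + 1 - of_nat j) * g (j - 1))" for j
  define M where "M = n + 2"
  have le: "n + 2 \<le> M" "n + 1 \<le> M" "n \<le> M" by (simp_all add: M_def)
  have ext: "honeycomb_sum m = (\<Sum>j\<le>M. t m j * g j)" if "m \<le> M" for m
  proof -
    have "honeycomb_sum m = (\<Sum>j\<le>m. t m j * g j)"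
      unfolding honeycomb_sum_def
    proof (intro sum.cong refl)
      fix j assume "j \<in> {..m}"
      then have j: "j \<le> m" by simp
      have "of_nat ((m + j) choose (2 * j)) = fact (m + j) / (fact (2 * j) * fact (m - j) :: rat)"
        using j by (subst binomial_fact) auto
      then show "of_nat ((2 * j) choose j) * of_nat ((m + j) choose (2 * j)) * (-9) ^ (m - j) * of_nat (honeycomb j)
          = t m j * g j"
        using power_diff_reciprocal[of "-9", OF _ j]
        by (simp add: t_def g_def recip_fact_diff[OF j] recip_fact_of_nat central_binomial_fact power_divide)
    qed
    also have "\<dots> = (\<Sum>j\<le>M. t m j * g j)"
      using that by (intro sum_atMost_extend) (auto simp: t_def recip_fact_neg)
    finally show ?thesis .
  qed
  have step: "(N + 1) ^ 3 * (t (n + 2) j * g j) + (2 * N + 1) * (7 * N\<^sup>2 + 7 * N + 3) * (t (n + 1) j * g j)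
      + 81 * N ^ 3 * (t n j * g j) = G (Suc j) - G j" for j
  proof -
    define J :: rat where "J = of_nat j"
    define R where "R = recip_fact (int n + 2 - int j)"
    define \<rho> where "\<rho> = recip_fact (int (Suc j))"
    have \<rho>: "recip_fact (int j) = (J + 1) * \<rho>"
      unfolding \<rho>_def J_def by (rule recip_fact_nat_step)
    have R1: "recip_fact (int n + 1 - int j) = (N + 1 - J) * R"
      using recip_fact_diff_steps(2)[of n j] unfolding N_def J_def R_def by simp
    have R0: "recip_fact (int n - int j) = (N - J) * ((N + 1 - J) * R)"
      using recip_fact_diff_steps(1)[of n j] R1 unfolding N_def J_def by simp
    have f1: "fact (n + 1 + j) = (N + J) * (fact (n + j) :: rat)"
      by (simp add: N_def J_def)
    have f2: "fact (n + 2 + j) = (N + J + 1) * (N + J) * (fact (n + j) :: rat)"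
      by (simp add: N_def J_def algebra_simps)
    have f3: "fact (n + Suc j) = (N + J) * (fact (n + j) :: rat)"
      by (simp add: N_def J_def algebra_simps)
    have i2: "int (n + 2) - int j = int n + 2 - int j" and i1: "int (n + 1) - int j = int n + 1 - int j"
      by simp_all
    have t2: "t (n + 2) j = 81 * (N + J + 1) * (N + J) * b j"
      unfolding t_def b_def f2 i2 by simp
    have t1: "t (n + 1) j = - 9 * (N + J) * (N + 1 - J) * b j"
      unfolding t_def b_def f1 i1 R1 R_def[symmetric] by (simp add: algebra_simps)
    have t0: "t n j = (N - J) * (N + 1 - J) * b j"
      unfolding t_def b_def R0 R_def[symmetric] by simp
    have bS: "(J + 1) ^ 2 * b (Suc j) = (N + J) * (N + 1 - J) * (- 1 / 9) * b j"
    proof -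
      have e: "int n + 2 - int (Suc j) = int n + 1 - int j" by simp
      show ?thesis
        unfolding b_def e f3 R1 \<rho> R_def[symmetric] \<rho>_def[symmetric] power_Suc power_mult_distrib
        by (simp only: ac_simps)
    qed
    have rec: "(J + 1)\<^sup>2 * g (Suc j) = (10 * J\<^sup>2 + 10 * J + 3) * g j - 9 * J\<^sup>2 * g (j - 1)"
    proof (cases j)
      case 0
      then show ?thesis by (simp add: J_def g_def honeycomb_def)
    next
      case (Suc i)
      then show ?thesis using honeycomb_rec[of i] by (simp add: J_def g_def algebra_simps)
    qed
    have GS: "G (Suc j) = - 162 * (2 * N + 1) * ((J + 1) ^ 2 * b (Suc j))
       * ((J + 1)\<^sup>2 * g (Suc j) + (N + J + 1) * (N - J) * g j)"
      by (simp add: G_def J_def algebra_simps)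
    have Gk: "G j = - 162 * (2 * N + 1) * J ^ 2 * b j * (J ^ 2 * g j + (N + J) * (N + 1 - J) * g (j - 1))"
      by (simp add: G_def J_def)
    show ?thesis unfolding GS Gk t2 t1 t0 bS rec
      by (simp add: power2_eq_square power3_eq_cube power4_eq_xxxx field_simps)
  qed
  have "(\<Sum>j\<le>M. (N + 1) ^ 3 * (t (n + 2) j * g j) + (2 * N + 1) * (7 * N\<^sup>2 + 7 * N + 3) * (t (n + 1) j * g j)
      + 81 * N ^ 3 * (t n j * g j)) = G (Suc M) - G 0"
    unfolding step lessThan_Suc_atMost[symmetric] by (rule sum_lessThan_telescope)
  also have "\<dots> = 0" by (simp add: G_def b_def recip_fact_neg M_def)
  finally have "(N + 1) ^ 3 * honeycomb_sum (n + 2) + (2 * N + 1) * (7 * N\<^sup>2 + 7 * N + 3) * honeycomb_sum (n + 1)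
      + 81 * N ^ 3 * honeycomb_sum n = 0"
    by (simp only: ext[OF le(1)] ext[OF le(2)] ext[OF le(3)] sum.distrib sum_distrib_left)
  moreover have "of_nat n = N - 1" by (simp add: N_def)
  ultimately show ?thesis by (simp only:) (simp add: algebra_simps)
qed

lemma honeycomb_sum_eq_almkvist_zudilin: "honeycomb_sum n = almkvist_zudilin n"
proof (induction n rule: less_induct)
  case (less n)
  consider "n = 0" | "n = 1" | i where "n = i + 2"
    by (metis One_nat_def add_2_eq_Suc' not0_implies_Suc)
  then show ?case
  proof cases
    case 1
    then show ?thesis by (simp add: honeycomb_sum_def almkvist_zudilin_def honeycomb_def)
  next
    case 2
    have "(4 choose 2) = (6 :: nat)" by (simp add: eval_nat_numeral)
    with 2 show ?thesis
      by (simp add: honeycomb_sum_def almkvist_zudilin_def honeycomb_def numeral_2_eq_2)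
  next
    case (3 i)
    have "(of_nat i + 2) ^ 3 \<noteq> (0 :: rat)"
      using of_nat_0_le_iff[of i, where 'a = rat] by (simp add: add_nonneg_eq_0_iff)
    moreover have "(of_nat i + 2) ^ 3 * honeycomb_sum n = (of_nat i + 2) ^ 3 * almkvist_zudilin n"
      using less[of i] less[of "i + 1"] unfolding 3 honeycomb_sum_rec almkvist_zudilin_rec by simp
    ultimately show ?thesis by (simp only: mult_cancel_left) simp
  qed
qed

section \<open>Congruences between p-integral rational numbers\<close>

context
  fixes p :: nat
  assumes p: "prime p"
begin

lemma zp_iff: "x \<in> zp p \<longleftrightarrow> (\<exists>a b. \<not> int p dvd b \<and> x = of_int a / of_int b)"
proof
  assume "x \<in> zp p"
  then show "\<exists>a b. \<not> int p dvd b \<and> x = of_int a / of_int b"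
    by (metis (no_types, lifting) mem_Collect_eq prod.collapse quotient_of_div zp_def)
next
  assume "\<exists>a b. \<not> int p dvd b \<and> x = of_int a / of_int b"
  then obtain a b where b: "\<not> int p dvd b" "x = of_int a / of_int b" by blast
  obtain u v where uv: "quotient_of x = (u, v)" by force
  have v: "v > 0" "coprime u v" "x = of_int u / of_int v"
    using uv quotient_of_denom_pos quotient_of_coprime quotient_of_div by auto
  have "b \<noteq> 0" using b by auto
  then have "(of_int (a * v) :: rat) = of_int (u * b)" using v b by (simp add: field_simps)
  then have "a * v = u * b" by (simp only: of_int_eq_iff)
  then have "v dvd b" using v(2) by (metis coprime_commute coprime_dvd_mult_right_iff dvd_triv_right)
  then show "x \<in> zp p" using b uv dvd_trans by (auto simp: zp_def)
qed

lemma prime_int_p: "prime (int p)" using p by simp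

lemma zp_of_int [simp]: "of_int a \<in> zp p"
  unfolding zp_iff using p by (intro exI[of _ a] exI[of _ 1]) (auto simp: prime_nat_iff)

lemma zp_of_nat [simp]: "of_nat a \<in> zp p"
  using zp_of_int[of "int a"] by simp

lemma zp_numeral [simp]: "numeral a \<in> zp p"
  using zp_of_int[of "numeral a"] by simp

lemma zp_0 [simp]: "0 \<in> zp p" and zp_1 [simp]: "1 \<in> zp p"
  using zp_of_int[of 0] zp_of_int[of 1] by simp_all

lemma zp_add [simp]: "x \<in> zp p \<Longrightarrow> y \<in> zp p \<Longrightarrow> x + y \<in> zp p"
proof -
  assume "x \<in> zp p" "y \<in> zp p"
  then obtain a b c d where *: "\<not> int p dvd b" "x = of_int a / of_int b" "\<not> int p dvd d" "y = of_int c / of_int d"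
    unfolding zp_iff by blast
  moreover from * have "b \<noteq> 0" "d \<noteq> 0" by auto
  ultimately have "x + y = of_int (a * d + c * b) / of_int (b * d)" "\<not> int p dvd b * d"
    using prime_int_p by (auto simp: field_simps prime_dvd_mult_iff)
  then show ?thesis unfolding zp_iff by blast
qed

lemma zp_mult [simp]: "x \<in> zp p \<Longrightarrow> y \<in> zp p \<Longrightarrow> x * y \<in> zp p"
proof -
  assume "x \<in> zp p" "y \<in> zp p"
  then obtain a b c d where *: "\<not> int p dvd b" "x = of_int a / of_int b" "\<not> int p dvd d" "y = of_int c / of_int d"
    unfolding zp_iff by blast
  then have "x * y = of_int (a * c) / of_int (b * d)" "\<not> int p dvd b * d"
    using prime_int_p by (auto simp: prime_dvd_mult_iff)
  then show ?thesis unfolding zp_iff by blast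
qed

lemma zp_minus [simp]: "x \<in> zp p \<Longrightarrow> - x \<in> zp p"
  using zp_mult[OF zp_of_int[of "- 1"], of x] by simp

lemma zp_power [simp]: "x \<in> zp p \<Longrightarrow> x ^ n \<in> zp p"
  by (induction n) auto

lemma zp_sum [simp]: "(\<And>i. i \<in> A \<Longrightarrow> f i \<in> zp p) \<Longrightarrow> sum f A \<in> zp p"
  by (induction A rule: infinite_finite_induct) auto

lemma zp_cong_refl [simp]: "zp_cong p x x \<longleftrightarrow> x \<in> zp p"
  by (auto simp: zp_cong_def intro!: bexI[of _ 0])

lemma zp_cong_sym: "zp_cong p x y \<Longrightarrow> zp_cong p y x"
  unfolding zp_cong_def by (metis minus_diff_eq mult_minus_right zp_minus)

lemma zp_cong_trans [trans]: "zp_cong p x y \<Longrightarrow> zp_cong p y z \<Longrightarrow> zp_cong p x z"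
proof -
  assume "zp_cong p x y" "zp_cong p y z"
  then obtain c d where "x \<in> zp p" "z \<in> zp p" "c \<in> zp p" "d \<in> zp p"
      "x - y = of_nat p * c" "y - z = of_nat p * d" unfolding zp_cong_def by blast
  moreover from this have "x - z = of_nat p * (c + d)" by (simp add: algebra_simps)
  ultimately show ?thesis unfolding zp_cong_def using zp_add by blast
qed

lemma zp_cong_add: "zp_cong p x y \<Longrightarrow> zp_cong p u v \<Longrightarrow> zp_cong p (x + u) (y + v)"
proof -
  assume "zp_cong p x y" "zp_cong p u v"
  then obtain c d where *: "x \<in> zp p" "y \<in> zp p" "u \<in> zp p" "v \<in> zp p" "c \<in> zp p" "d \<in> zp p"
      "x - y = of_nat p * c" "u - v = of_nat p * d" unfolding zp_cong_def by blast
  then have "x + u - (y + v) = of_nat p * (c + d)" by (simp add: algebra_simps)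
  then show ?thesis unfolding zp_cong_def using * zp_add by blast
qed

lemma zp_cong_mult: "zp_cong p x y \<Longrightarrow> zp_cong p u v \<Longrightarrow> zp_cong p (x * u) (y * v)"
proof -
  assume "zp_cong p x y" "zp_cong p u v"
  then obtain c d where *: "x \<in> zp p" "y \<in> zp p" "u \<in> zp p" "v \<in> zp p" "c \<in> zp p" "d \<in> zp p"
      "x - y = of_nat p * c" "u - v = of_nat p * d" unfolding zp_cong_def by blast
  have "x * u - y * v = (x - y) * u + y * (u - v)" by (simp add: algebra_simps)
  also have "\<dots> = of_nat p * (c * u + y * d)" using * by (simp add: algebra_simps)
  finally have "x * u - y * v = of_nat p * (c * u + y * d)" .
  moreover have "x * u \<in> zp p" "y * v \<in> zp p" "c * u + y * d \<in> zp p" using * by simp_all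
  ultimately show ?thesis unfolding zp_cong_def by blast
qed

lemma zp_cong_power: "zp_cong p x y \<Longrightarrow> zp_cong p (x ^ n) (y ^ n)"
  by (induction n) (auto intro: zp_cong_mult)

lemma zp_cong_sum: "(\<And>i. i \<in> A \<Longrightarrow> zp_cong p (f i) (g i)) \<Longrightarrow> zp_cong p (sum f A) (sum g A)"
  by (induction A rule: infinite_finite_induct) (auto intro: zp_cong_add)

lemma zp_cong_of_int: "[a = b] (mod int p) \<Longrightarrow> zp_cong p (of_int a) (of_int b)"
proof -
  assume "[a = b] (mod int p)"
  then obtain k where "a - b = int p * k" by (auto simp: cong_iff_dvd_diff)
  then have "of_int a - of_int b = of_nat p * (of_int k :: rat)"
    by (metis of_int_diff of_int_mult of_int_of_nat_eq)
  then show ?thesis unfolding zp_cong_def using zp_of_int by blast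
qed

lemma zp_cong_of_nat_0: "p dvd a \<Longrightarrow> zp_cong p (of_nat a) 0"
  using zp_cong_of_int[of "int a" 0] by (simp add: cong_iff_dvd_diff)

lemma zp_cong_residue: "x \<in> zp p \<Longrightarrow> zp_cong p x (of_int (zp_residue p x))"
  unfolding zp_residue_def using theI'[OF zp_residue_ex1[OF p]] by blast

lemma zp_inverse:
  assumes "x \<in> zp p" "\<not> zp_cong p x 0"
  shows "inverse x \<in> zp p"
proof -
  obtain a b where ab: "\<not> int p dvd b" "x = of_int a / of_int b" using assms(1) unfolding zp_iff by blast
  have "\<not> int p dvd a"
  proof
    assume "int p dvd a"
    then have "zp_cong p (of_int a) 0" using zp_cong_of_int[of a 0] by (simp add: cong_iff_dvd_diff)
    moreover have "1 / of_int b \<in> zp p" using ab zp_iff by (metis of_int_1)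
    ultimately have "zp_cong p (of_int a * (1 / of_int b)) (0 * (1 / of_int b))"
      by (intro zp_cong_mult) auto
    then show False using assms(2) ab by simp
  qed
  then show ?thesis unfolding zp_iff ab by (intro exI[of _ b] exI[of _ a]) simp
qed

lemma zp_cong_fermat:
  assumes "x \<in> zp p" "\<not> zp_cong p x 0"
  shows "zp_cong p (x ^ (p - 1)) 1"
proof -
  define r where "r = zp_residue p x"
  have xr: "zp_cong p x (of_int r)" unfolding r_def by (rule zp_cong_residue[OF assms(1)])
  have "r \<ge> 0" unfolding r_def zp_residue_def using theI'[OF zp_residue_ex1[OF p assms(1)]] by blast
  then obtain n where n: "r = int n" by (metis nonneg_int_cases)
  have "\<not> p dvd n" using xr assms(2) zp_cong_trans zp_cong_of_nat_0 n by (metis of_int_of_nat_eq)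
  then have "[n ^ (p - 1) = 1] (mod p)" using p by (rule fermat_theorem[rotated])
  then have "[int n ^ (p - 1) = 1] (mod int p)" by (metis cong_int_iff of_nat_1 of_nat_power)
  then have "zp_cong p (of_int r ^ (p - 1)) 1" using zp_cong_of_int[of "r ^ (p - 1)" 1] n by simp
  then show ?thesis using zp_cong_power[OF xr] zp_cong_trans by blast
qed

lemma zp_cong_euler:
  assumes "p > 2" "x \<in> zp p" "zp_Legendre x p = 1"
  shows "zp_cong p (x ^ ((p - 1) div 2)) 1"
proof -
  have xr: "zp_cong p x (of_int (zp_residue p x))" by (rule zp_cong_residue[OF assms(2)])
  have "[zp_residue p x ^ ((p - 1) div 2) = 1] (mod int p)"
    using euler_criterion[OF p assms(1), of "zp_residue p x"] assms(3) cong_sym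
    by (auto simp: zp_Legendre_def)
  then have "zp_cong p (of_int (zp_residue p x) ^ ((p - 1) div 2)) 1" using zp_cong_of_int by fastforce
  then show ?thesis using zp_cong_power[OF xr] zp_cong_trans by blast
qed

text \<open>The device that clears denominators: a unit \<open>D\<close> with \<open>D ^ m \<equiv> 1\<close> satisfies \<open>D ^ (- k) \<equiv> D ^ (m - k)\<close>, which is
polynomial in \<open>D\<close>.\<close>

lemma zp_cong_divide_power:
  assumes x: "x \<in> zp p" and D: "D \<in> zp p" and m: "zp_cong p (D ^ m) 1" and k: "k \<le> m" and m0: "m > 0"
  shows "zp_cong p ((x / D) ^ k) (x ^ k * D ^ (m - k))" "x / D \<in> zp p"
proof -
  have nz: "\<not> zp_cong p D 0"
  proof
    assume "zp_cong p D 0"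
    then have "zp_cong p (D ^ m) 0" using zp_cong_power[of D 0 m] m0 by (simp add: power_0_left)
    then have "zp_cong p 1 0" using m zp_cong_sym zp_cong_trans by blast
    then obtain c where "c \<in> zp p" "1 = of_nat p * c" unfolding zp_cong_def by auto
    then obtain a b where ab: "\<not> int p dvd b" "1 = of_nat p * (of_int a / of_int b :: rat)"
      unfolding zp_iff by blast
    then have "(of_int b :: rat) = of_int (int p * a)" by (cases "b = 0") (auto simp: field_simps)
    then have "b = int p * a" by (simp only: of_int_eq_iff)
    then show False using ab by simp
  qed
  have i: "inverse D \<in> zp p" using zp_inverse[OF D nz] .
  then show xD: "x / D \<in> zp p" using x zp_mult by (simp add: divide_inverse)
  have "D \<noteq> 0" using nz by auto
  then have e: "(x / D) ^ k * D ^ m = x ^ k * D ^ (m - k)"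
    using k by (simp add: power_divide power_diff)
  have "zp_cong p ((x / D) ^ k * 1) ((x / D) ^ k * D ^ m)"
    using m xD by (intro zp_cong_mult zp_cong_sym[OF m]) auto
  then show "zp_cong p ((x / D) ^ k) (x ^ k * D ^ (m - k))" using e by simp
qed

section \<open>Congruences for binomial coefficients\<close>

lemma cong_cancel_Suc:
  assumes "Suc k < p" "[int (Suc k) * a = int (Suc k) * b] (mod int p)"
  shows "[a = b] (mod int p)"
proof -
  have "\<not> int p dvd int (Suc k)" using assms(1) by (auto dest: dvd_imp_le simp del: of_nat_Suc)
  then have "coprime (int (Suc k)) (int p)"
    using prime_imp_coprime[OF prime_int_p] coprime_commute by blast
  then show ?thesis using assms(2) cong_mult_lcancel by blast
qed

text \<open>In the integers the relation holds for \<open>k > m\<close> as well, so that the inductions below can run past the point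
where the binomial coefficient vanishes.\<close>

lemma Suc_times_binomial_int: "int (Suc k) * int (m choose Suc k) = (int m - int k) * int (m choose k)"
proof (cases "k \<le> m")
  case True
  have "(m - k) * (m choose k) = Suc k * (m choose Suc k)"
  proof (cases m)
    case (Suc l)
    then show ?thesis
      using binomial_absorb_comp[of m k] Suc_times_binomial[of k l] by simp
  qed (use True in simp)
  then show ?thesis using True by (metis of_nat_diff of_nat_mult)
qed (simp add: binomial_eq_0)

text \<open>Modulo \<open>p\<close> the number \<open>m\<close> is \<open>- 1 / 2\<close>, and \<open>C(2 k, k) = (- 4) ^ k * C(- 1 / 2, k)\<close>.\<close>

lemma central_binomial_cong:
  assumes "p = 2 * m + 1" "k < p"
  shows "[int ((2 * k) choose k) = (-4) ^ k * int (m choose k)] (mod int p)"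
  using assms(2)
proof (induction k)
  case (Suc k)
  have nat: "Suc k * ((2 * Suc k) choose Suc k) = 2 * (2 * k + 1) * ((2 * k) choose k)"
  proof -
    have "(2 * k + 1) choose k = (2 * k + 1) choose Suc k"
      by (subst binomial_symmetric) auto
    moreover have "Suc k * ((2 * Suc k) choose Suc k) = (2 * k + 2) * ((2 * k + 1) choose k)"
      using Suc_times_binomial[of k "2 * k + 1"] by simp
    moreover have "Suc k * ((2 * k + 1) choose Suc k) = (2 * k + 1) * ((2 * k) choose k)"
      using Suc_times_binomial[of k "2 * k"] by simp
    ultimately show ?thesis by (simp add: algebra_simps)
  qed
  have "int (Suc k) * int ((2 * Suc k) choose Suc k) = 2 * (2 * int k + 1) * int ((2 * k) choose k)"
    using arg_cong[OF nat, of int] by (simp only: of_nat_mult of_nat_add of_nat_numeral of_nat_1)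
  also have "[2 * (2 * int k + 1) * int ((2 * k) choose k)
      = (-4 * (int m - int k)) * ((-4) ^ k * int (m choose k))] (mod int p)"
  proof (rule cong_mult)
    have "2 * (2 * int k + 1) - (-4 * (int m - int k)) = int p * 2" using assms(1) by simp
    then show "[2 * (2 * int k + 1) = -4 * (int m - int k)] (mod int p)"
      unfolding cong_iff_dvd_diff by simp
  qed (use Suc in simp)
  also have "(-4 * (int m - int k)) * ((-4) ^ k * int (m choose k))
      = (-4) ^ Suc k * ((int m - int k) * int (m choose k))" by (simp add: algebra_simps)
  also have "\<dots> = int (Suc k) * ((-4) ^ Suc k * int (m choose Suc k))"
    unfolding Suc_times_binomial_int[symmetric] by simp
  finally show ?case by (rule cong_cancel_Suc[OF Suc.prems])
qed simp

text \<open>Modulo \<open>p\<close> the upper entry is \<open>- 1 - r\<close>, and \<open>C(- 1 - r, i) = (- 1) ^ i * C(r + i, i)\<close>.\<close>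

lemma binomial_reflection_cong:
  assumes "r < p" "i < p"
  shows "[int ((p - 1 - r) choose i) = (-1) ^ i * int ((r + i) choose i)] (mod int p)"
  using assms(2)
proof (induction i)
  case (Suc i)
  have "int (Suc i) * int ((p - 1 - r) choose Suc i) = (int (p - 1 - r) - int i) * int ((p - 1 - r) choose i)"
    by (rule Suc_times_binomial_int)
  also have "int (p - 1 - r) - int i = int p - int (r + i + 1)" using assms(1) by simp
  also have "[(int p - int (r + i + 1)) * int ((p - 1 - r) choose i)
      = (- int (r + i + 1)) * ((-1) ^ i * int ((r + i) choose i))] (mod int p)"
    using Suc by (intro cong_mult) (auto simp: cong_iff_dvd_diff)
  also have "(- int (r + i + 1)) * ((-1) ^ i * int ((r + i) choose i))
      = (-1) ^ Suc i * (int (r + i + 1) * int ((r + i) choose i))" by (simp add: algebra_simps)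
  also have "int (r + i + 1) * int ((r + i) choose i) = int (Suc i) * int ((r + Suc i) choose Suc i)"
    using Suc_times_binomial_eq[of "r + i" i] by (metis Suc_eq_plus1 add_Suc_right mult.commute of_nat_mult)
  finally have "[int (Suc i) * int ((p - 1 - r) choose Suc i)
      = int (Suc i) * ((-1) ^ Suc i * int ((r + Suc i) choose Suc i))] (mod int p)"
    by (simp only: ac_simps)
  then show ?case by (rule cong_cancel_Suc[OF Suc.prems])
qed simp

section \<open>Expansion into a polynomial of degree below p\<close>

text \<open>Modulo \<open>p\<close> the left side is the expansion of \<open>W * (1 + y) ^ (- 1 - r)\<close>, cut off at a degree that may exceed the
exponent \<open>p - 1 - r\<close>. The additional terms vanish modulo \<open>p\<close>. When \<open>r \<ge> p\<close> the exponent on the left is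
truncated to 0, and the factor \<open>W\<close> makes both sides vanish.\<close>

lemma zp_cong_binomial_expansion:
  assumes y: "y \<in> zp p" and W: "p \<le> r \<Longrightarrow> p dvd W" and k: "k \<le> r"
  shows "zp_cong p (of_nat W * (1 + y) ^ (p - 1 - r))
           (\<Sum>i\<le>p - 1 - k. of_nat (W * ((r + i) choose i)) * (- y) ^ i)"
proof (cases "r < p")
  case True
  have "(1 + y) ^ (p - 1 - r) = (\<Sum>i\<le>p - 1 - r. of_nat ((p - 1 - r) choose i) * y ^ i)"
    using binomial_ring[of y 1 "p - 1 - r"] by (simp add: add.commute)
  also have "\<dots> = (\<Sum>i\<le>p - 1 - k. of_nat ((p - 1 - r) choose i) * y ^ i)"
    using k by (intro sum.mono_neutral_left) (auto simp: not_le binomial_eq_0)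
  finally have "of_nat W * (1 + y) ^ (p - 1 - r)
      = (\<Sum>i\<le>p - 1 - k. of_nat W * (of_nat ((p - 1 - r) choose i) * y ^ i))"
    by (simp add: sum_distrib_left)
  also have "zp_cong p \<dots> (\<Sum>i\<le>p - 1 - k. of_nat W * (((-1) ^ i * of_nat ((r + i) choose i)) * y ^ i))"
  proof (intro zp_cong_sum zp_cong_mult)
    fix i assume "i \<in> {..p - 1 - k}"
    then have "i < p" using True by auto
    then show "zp_cong p (of_nat ((p - 1 - r) choose i)) ((-1) ^ i * of_nat ((r + i) choose i))"
      using zp_cong_of_int[OF binomial_reflection_cong[OF True]] by simp
  qed (use y in auto)
  also have "\<dots> = (\<Sum>i\<le>p - 1 - k. of_nat (W * ((r + i) choose i)) * (- y) ^ i)"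
    by (intro sum.cong refl) (simp add: power_minus[of y] ac_simps)
  finally show ?thesis .
next
  case False
  then have 0: "zp_cong p (of_nat W) 0" using W zp_cong_of_nat_0 by simp
  have "zp_cong p (of_nat W * (1 + y) ^ (p - 1 - r)) (0 * (1 + y) ^ (p - 1 - r))"
    using y by (intro zp_cong_mult 0) simp
  also have "0 * (1 + y) ^ (p - 1 - r) = (\<Sum>i\<le>p - 1 - k. 0 * (of_nat ((r + i) choose i) * (- y) ^ i))"
    by simp
  also have "zp_cong p \<dots> (\<Sum>i\<le>p - 1 - k. of_nat W * (of_nat ((r + i) choose i) * (- y) ^ i))"
    using y by (intro zp_cong_sum zp_cong_mult zp_cong_sym[OF 0]) simp_all
  finally show ?thesis by (simp add: mult.assoc)
qed

text \<open>The common step of both halves of the proof. The cut-off \<open>p - 1 - k\<close> in the expansion of the \<open>k\<close>-th term is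
chosen so that collecting terms by \<open>n = k + i\<close> gives the full coefficients for all \<open>n < p\<close>.\<close>

lemma zp_cong_truncated_series:
  fixes W :: "nat \<Rightarrow> nat"
  assumes y: "y \<in> zp p" and z: "z \<in> zp p" and c: "c \<ge> 1"
    and W: "\<And>k. k < p \<Longrightarrow> p \<le> c * k \<Longrightarrow> p dvd W k"
  shows "zp_cong p (\<Sum>k\<le>p - 1. of_nat (W k) * z ^ k * (1 + y) ^ (p - 1 - c * k))
    (\<Sum>n\<le>p - 1. \<Sum>k\<le>n. of_nat (W k * ((c * k + (n - k)) choose (n - k))) * z ^ k * (- y) ^ (n - k))"
proof -
  have p0: "p > 0" using p prime_gt_0_nat by blast
  have "zp_cong p (\<Sum>k\<le>p - 1. z ^ k * (of_nat (W k) * (1 + y) ^ (p - 1 - c * k)))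
     (\<Sum>k\<le>p - 1. z ^ k * (\<Sum>i\<le>p - 1 - k. of_nat (W k * ((c * k + i) choose i)) * (- y) ^ i))"
  proof (intro zp_cong_sum zp_cong_mult zp_cong_binomial_expansion)
    fix k assume "k \<in> {..p - 1}"
    then have "k < p" using p0 by auto
    then show "p dvd W k" if "p \<le> c * k" using W that by blast
    show "k \<le> c * k" using c by simp
  qed (use y z in simp_all)
  also have "(\<Sum>k\<le>p - 1. z ^ k * (\<Sum>i\<le>p - 1 - k. of_nat (W k * ((c * k + i) choose i)) * (- y) ^ i))
      = (\<Sum>k\<le>p - 1. \<Sum>i\<le>p - 1 - k. of_nat (W k * ((c * k + i) choose i)) * z ^ k * (- y) ^ i)"
    by (simp add: sum_distrib_left ac_simps)
  also have "\<dots> = (\<Sum>(k, i)\<in>{(k, i). k + i \<le> p - 1}. of_nat (W k * ((c * k + i) choose i)) * z ^ k * (- y) ^ i)"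
    by (subst sum.Sigma) (auto intro!: sum.cong)
  also have "\<dots> = (\<Sum>n\<le>p - 1. \<Sum>k\<le>n. of_nat (W k * ((c * k + (n - k)) choose (n - k))) * z ^ k * (- y) ^ (n - k))"
    by (rule sum.triangle_reindex_eq)
  finally show ?thesis by (simp add: ac_simps)
qed

lemma not_p_dvd_fact_power: "k < p \<Longrightarrow> \<not> p dvd fact k ^ e"
  using p prime_dvd_power prime_dvd_fact_iff not_le by blast

lemma p_dvd_central_binomial:
  assumes "k < p" "p \<le> 2 * k"
  shows "p dvd ((2 * k) choose k)"
proof -
  have "fact k ^ 2 * ((2 * k) choose k) = fact (2 * k)"
    using binomial_fact_lemma[of k "2 * k"] by (simp add: power2_eq_square)
  then have "p dvd fact k ^ 2 * ((2 * k) choose k)"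
    using assms(2) p prime_dvd_fact_iff by metis
  then show ?thesis using not_p_dvd_fact_power[OF assms(1)] p prime_dvd_mult_iff by blast
qed

text \<open>The product equals \<open>(4 k)! / k! ^ 4\<close>.\<close>

lemma p_dvd_quartic_multinomial:
  assumes "k < p" "p \<le> 4 * k"
  shows "p dvd ((2 * k) choose k)\<^sup>2 * ((4 * k) choose (2 * k))"
proof -
  have half: "fact k * fact k * ((2 * k) choose k) = fact (2 * k)"
    using binomial_fact_lemma[of k "2 * k"] by simp
  have full: "fact (2 * k) * fact (2 * k) * ((4 * k) choose (2 * k)) = fact (4 * k)"
    using binomial_fact_lemma[of "2 * k" "4 * k"] by simp
  have "fact k ^ 4 * (((2 * k) choose k)\<^sup>2 * ((4 * k) choose (2 * k)))
      = (fact k * fact k * ((2 * k) choose k)) * (fact k * fact k * ((2 * k) choose k)) * ((4 * k) choose (2 * k))"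
    by (simp only: power2_eq_square power4_eq_xxxx ac_simps)
  also have "\<dots> = fact (4 * k)" by (simp only: half full)
  finally have "fact k ^ 4 * (((2 * k) choose k)\<^sup>2 * ((4 * k) choose (2 * k))) = fact (4 * k)" .
  then have "p dvd fact k ^ 4 * (((2 * k) choose k)\<^sup>2 * ((4 * k) choose (2 * k)))"
    using assms(2) p prime_dvd_fact_iff by metis
  then show ?thesis using not_p_dvd_fact_power[OF assms(1)] p prime_dvd_mult_iff by blast
qed

lemma not_zp_cong_of_nat_0:
  assumes "\<not> p dvd n"
  shows "\<not> zp_cong p (of_nat n) 0"
proof
  assume "zp_cong p (of_nat n) 0"
  then obtain c where "c \<in> zp p" "of_nat n = of_nat p * c" unfolding zp_cong_def by auto
  then obtain a b where ab: "\<not> int p dvd b" "of_nat n = of_nat p * (of_int a / of_int b :: rat)"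
    unfolding zp_iff by blast
  then have "b \<noteq> 0" by auto
  then have "(of_int (int n * b) :: rat) = of_int (int p * a)" using ab(2) by (simp add: field_simps)
  then have "int n * b = int p * a" by (simp only: of_int_eq_iff)
  then have "int p dvd int n * b" by simp
  from prime_dvd_multD[OF prime_int_p this] show False using ab(1) assms by simp
qed

section \<open>The two sides of the congruence\<close>

lemma zp_cong_quartic_series:
  assumes p3: "p > 3" and x: "x \<in> zp p" and u: "\<not> zp_cong p (1 + 3 * x) 0"
  shows "zp_cong p
    (\<Sum>k\<le>p - 1. of_nat (((2 * k) choose k) ^ 2 * ((4 * k) choose (2 * k))) * (x / (9 * (1 + 3 * x) ^ 4)) ^ k)
    (\<Sum>n\<le>p - 1. almkvist_zudilin n * (x / 9) ^ n)"
proof -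
  define W where "W k = ((2 * k) choose k) ^ 2 * ((4 * k) choose (2 * k))" for k
  define v where "v = 1 + 3 * x"
  have v: "v \<in> zp p" "\<not> zp_cong p v 0" using x u by (simp_all add: v_def)
  have "\<not> p dvd 3" using p3 by (auto dest: dvd_imp_le)
  then have "\<not> p dvd 3 ^ 2" using prime_dvd_power[OF p, of 3 2] by blast
  then have "\<not> p dvd 9" by simp
  then have "inverse (of_nat 9) \<in> zp p" by (intro zp_inverse not_zp_cong_of_nat_0) simp_all
  then have "x * inverse (of_nat 9) \<in> zp p" by (rule zp_mult[OF x])
  then have x9: "x / 9 \<in> zp p" by (simp add: field_simps)
  have v1: "zp_cong p (v ^ (p - 1)) 1" by (rule zp_cong_fermat[OF v])
  have p1: "p - 1 > 0" using p3 by simp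
  have iv: "1 / v \<in> zp p" using zp_inverse[OF v] by (simp add: inverse_eq_divide)
  have split: "(x / (9 * v ^ 4)) ^ k = (x / 9) ^ k * (1 / v) ^ (4 * k)" for k
    by (simp add: power_mult power_divide power_mult_distrib)
  have "zp_cong p (\<Sum>k\<le>p - 1. of_nat (W k) * (x / (9 * v ^ 4)) ^ k)
      (\<Sum>k\<le>p - 1. of_nat (W k) * (x / 9) ^ k * (1 + 3 * x) ^ (p - 1 - 4 * k))"
  proof (intro zp_cong_sum)
    fix k assume "k \<in> {..p - 1}"
    then have k: "k < p" using p1 by auto
    show "zp_cong p (of_nat (W k) * (x / (9 * v ^ 4)) ^ k)
        (of_nat (W k) * (x / 9) ^ k * (1 + 3 * x) ^ (p - 1 - 4 * k))"
    proof (cases "4 * k < p")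
      case True
      then have "zp_cong p ((1 / v) ^ (4 * k)) (1 ^ (4 * k) * v ^ (p - 1 - 4 * k))"
        by (intro zp_cong_divide_power(1) v v1 p1) auto
      then have "zp_cong p ((of_nat (W k) * (x / 9) ^ k) * (1 / v) ^ (4 * k))
          ((of_nat (W k) * (x / 9) ^ k) * v ^ (p - 1 - 4 * k))"
        using x9 by (intro zp_cong_mult) simp_all
      then show ?thesis unfolding split v_def[symmetric] by (simp add: mult.assoc)
    next
      case False
      \<comment> \<open>The exponent \<open>p - 1 - 4 * k\<close> is truncated here, but both terms vanish modulo \<open>p\<close>.\<close>
      then have 0: "zp_cong p (of_nat (W k)) 0"
        unfolding W_def by (intro zp_cong_of_nat_0 p_dvd_quartic_multinomial k) simp
      have a: "(x / 9) ^ k * (1 / v) ^ (4 * k) \<in> zp p" and b: "(x / 9) ^ k * v ^ (p - 1 - 4 * k) \<in> zp p"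
        using x9 iv v by simp_all
      have "zp_cong p (of_nat (W k) * ((x / 9) ^ k * (1 / v) ^ (4 * k))) (0 * ((x / 9) ^ k * (1 / v) ^ (4 * k)))"
        by (rule zp_cong_mult[OF 0]) (simp only: zp_cong_refl a)
      moreover have "zp_cong p (of_nat (W k) * ((x / 9) ^ k * v ^ (p - 1 - 4 * k))) (0 * ((x / 9) ^ k * v ^ (p - 1 - 4 * k)))"
        by (rule zp_cong_mult[OF 0]) (simp only: zp_cong_refl b)
      ultimately show ?thesis
        unfolding split v_def[symmetric] mult_zero_left mult.assoc by (blast intro: zp_cong_trans zp_cong_sym)
    qed
  qed
  also have "zp_cong p \<dots> (\<Sum>n\<le>p - 1. \<Sum>k\<le>n. of_nat (W k * ((4 * k + (n - k)) choose (n - k)))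
      * (x / 9) ^ k * (- (3 * x)) ^ (n - k))"
  proof (rule zp_cong_truncated_series)
    show "p dvd W k" if "k < p" "p \<le> 4 * k" for k
      using that unfolding W_def by (rule p_dvd_quartic_multinomial)
  qed (use x x9 in simp_all)
  also have "\<dots> = (\<Sum>n\<le>p - 1. almkvist_zudilin n * (x / 9) ^ n)"
    unfolding almkvist_zudilin_def sum_distrib_right W_def
  proof (intro sum.cong refl)
    fix n k :: nat assume "k \<in> {..n}"
    then have k: "k \<le> n" by simp
    have "(4 * k + (n - k)) choose (n - k) = (n + 3 * k) choose (4 * k)"
      using k binomial_symmetric[of "4 * k" "n + 3 * k"] by (simp add: add.commute)
    moreover have "(- (3 * x)) ^ (n - k) = (-27) ^ (n - k) * (x / 9) ^ (n - k)"
      by (simp flip: power_mult_distrib)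
    moreover have "(x / 9) ^ n = (x / 9) ^ k * (x / 9) ^ (n - k)"
      using k by (simp flip: power_add)
    ultimately show "of_nat (((2 * k) choose k)\<^sup>2 * ((4 * k) choose (2 * k)) * ((4 * k + (n - k)) choose (n - k)))
        * (x / 9) ^ k * (- (3 * x)) ^ (n - k)
      = of_nat (((2 * k) choose k)\<^sup>2 * ((4 * k) choose (2 * k))) * of_nat ((n + 3 * k) choose (4 * k))
        * (-27) ^ (n - k) * (x / 9) ^ n"
      by (simp only: of_nat_mult ac_simps)
  qed
  finally show ?thesis unfolding W_def v_def .
qed

lemma zp_cong_franel_series:
  assumes p3: "p > 3" and x: "x \<in> zp p" and L: "zp_Legendre (9 * x ^ 2 + 14 * x + 9) p = 1"
  shows "zp_cong p
    (\<Sum>k\<le>p - 1. of_nat ((2 * k) choose k) * (x / (9 * x ^ 2 + 14 * x + 9)) ^ k * of_nat (franel k))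
    (\<Sum>n\<le>p - 1. honeycomb_sum n * (x / 9) ^ n)"
proof -
  define D where "D = 9 * x ^ 2 + 14 * x + 9"
  define m where "m = (p - 1) div 2"
  have "odd p" using p p3 prime_odd_nat by auto
  then have pm: "p = 2 * m + 1" unfolding m_def by presburger
  have m0: "m > 0" using pm p3 by simp
  have D: "D \<in> zp p" using x by (simp add: D_def)
  have Dm: "zp_cong p (D ^ m) 1"
    unfolding m_def using p3 D L by (intro zp_cong_euler) (simp_all add: D_def)
  have "\<not> p dvd 3" using p3 by (auto dest: dvd_imp_le)
  then have "zp_cong p (3 ^ (p - 1)) 1"
    using zp_cong_fermat[OF _ not_zp_cong_of_nat_0[of 3]] by simp
  moreover have "(3 :: rat) ^ (p - 1) = 9 ^ m" using pm by (simp add: power_mult)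
  ultimately have nine: "zp_cong p (9 ^ m) 1" by simp
  have x9: "x / 9 \<in> zp p" by (rule zp_cong_divide_power(2)[OF x _ nine _ m0, of 0]) simp_all
  have xD: "x / D \<in> zp p" by (rule zp_cong_divide_power(2)[OF x D Dm _ m0, of 0]) simp
  have central: "zp_cong p (of_nat ((2 * k) choose k)) ((-4) ^ k * of_nat (m choose k))" if "k < p" for k
    using zp_cong_of_int[OF central_binomial_cong[OF pm that]] by simp
  have "zp_cong p (\<Sum>k\<le>p - 1. of_nat ((2 * k) choose k) * (x / D) ^ k * of_nat (franel k))
      (\<Sum>k\<le>p - 1. ((-4) ^ k * of_nat (m choose k)) * (x / D) ^ k * of_nat (franel k))"
    using xD p3 by (intro zp_cong_sum zp_cong_mult central) auto
  also have "\<dots> = (\<Sum>k\<le>m. ((-4) ^ k * of_nat (m choose k)) * (x / D) ^ k * of_nat (franel k))"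
    using pm by (intro sum.mono_neutral_right) (auto simp: not_le binomial_eq_0)
  also have "zp_cong p \<dots> (\<Sum>k\<le>m. ((-4) ^ k * of_nat (m choose k)) * (x ^ k * D ^ (m - k)) * of_nat (franel k))"
    by (intro zp_cong_sum zp_cong_mult zp_cong_divide_power(1)[OF x D Dm _ m0]) simp_all
  \<comment> \<open>The binomial transform replaces \<open>D\<close> by \<open>9 (1 + x)\<^sup>2\<close>, whose powers are, up to a constant, powers of \<open>1 + x\<close>.\<close>
  also have "\<dots> = (\<Sum>k\<le>m. of_nat (m choose k) * of_nat (franel k) * (-4 * x) ^ k * (-4 * x + 9 * (1 + x)\<^sup>2) ^ (m - k))"
  proof -
    have "D = -4 * x + 9 * (1 + x)\<^sup>2" by (simp add: D_def power2_eq_square algebra_simps)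
    then show ?thesis by (simp only: power_mult_distrib ac_simps)
  qed
  also have "\<dots> = (\<Sum>j\<le>m. of_nat (m choose j) * of_nat (honeycomb j) * (-4 * x) ^ j * (9 * (1 + x)\<^sup>2) ^ (m - j))"
    unfolding binomial_transform_homogeneous binomial_transform_franel ..
  also have "\<dots> = (\<Sum>j\<le>m. ((-4) ^ j * of_nat (m choose j) * of_nat (honeycomb j)) * (x ^ j * (1 + x) ^ (p - 1 - 2 * j)) * (1 ^ j * 9 ^ (m - j)))"
  proof (intro sum.cong refl)
    fix j
    have "p - 1 - 2 * j = 2 * (m - j)" using pm by simp
    then have "(9 * (1 + x)\<^sup>2) ^ (m - j) = 9 ^ (m - j) * (1 + x) ^ (p - 1 - 2 * j)"
      by (simp only: power_mult_distrib power_mult)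
    then show "of_nat (m choose j) * of_nat (honeycomb j) * (-4 * x) ^ j * (9 * (1 + x)\<^sup>2) ^ (m - j)
      = ((-4) ^ j * of_nat (m choose j) * of_nat (honeycomb j)) * (x ^ j * (1 + x) ^ (p - 1 - 2 * j)) * (1 ^ j * 9 ^ (m - j))"
      by (simp only: power_mult_distrib power_one mult_1_left ac_simps)
  qed
  \<comment> \<open>\<open>9 ^ m = 3 ^ (p - 1) \<equiv> 1\<close>, so that \<open>9\<close> is inverted in the same way as \<open>D\<close> was.\<close>
  also have "zp_cong p \<dots> (\<Sum>j\<le>m. ((-4) ^ j * of_nat (m choose j) * of_nat (honeycomb j)) * (x ^ j * (1 + x) ^ (p - 1 - 2 * j)) * (1 / 9) ^ j)"
    using x by (intro zp_cong_sum zp_cong_mult zp_cong_sym[OF zp_cong_divide_power(1)[OF _ _ nine _ m0]]) simp_all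
  also have "\<dots> = (\<Sum>j\<le>m. ((-4) ^ j * of_nat (m choose j)) * (of_nat (honeycomb j) * (x / 9) ^ j * (1 + x) ^ (p - 1 - 2 * j)))"
    by (simp add: power_divide ac_simps)
  \<comment> \<open>As \<open>C(m, j) = 0\<close> for \<open>j > m\<close>, the range may be all \<open>j < p\<close>, where the central binomial coefficients can be restored.\<close>
  also have "\<dots> = (\<Sum>j\<le>p - 1. ((-4) ^ j * of_nat (m choose j)) * (of_nat (honeycomb j) * (x / 9) ^ j * (1 + x) ^ (p - 1 - 2 * j)))"
    using pm by (intro sum.mono_neutral_left) (auto simp: not_le binomial_eq_0)
  also have "zp_cong p \<dots> (\<Sum>j\<le>p - 1. of_nat ((2 * j) choose j) * (of_nat (honeycomb j) * (x / 9) ^ j * (1 + x) ^ (p - 1 - 2 * j)))"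
    using x x9 p3 by (intro zp_cong_sum zp_cong_mult zp_cong_sym[OF central]) auto
  also have "\<dots> = (\<Sum>j\<le>p - 1. of_nat (((2 * j) choose j) * honeycomb j) * (x / 9) ^ j * (1 + x) ^ (p - 1 - 2 * j))"
    by (simp only: of_nat_mult mult.assoc)
  also have "zp_cong p \<dots> (\<Sum>n\<le>p - 1. \<Sum>j\<le>n. of_nat (((2 * j) choose j) * honeycomb j * ((2 * j + (n - j)) choose (n - j)))
      * (x / 9) ^ j * (- x) ^ (n - j))"
    using x x9 by (intro zp_cong_truncated_series) (simp_all add: p_dvd_central_binomial)
  also have "\<dots> = (\<Sum>n\<le>p - 1. honeycomb_sum n * (x / 9) ^ n)"
    unfolding honeycomb_sum_def sum_distrib_right
  proof (intro sum.cong refl)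
    fix n j :: nat assume "j \<in> {..n}"
    then have j: "j \<le> n" by simp
    have "(2 * j + (n - j)) choose (n - j) = (n + j) choose (2 * j)"
      using j binomial_symmetric[of "2 * j" "n + j"] by (simp add: add.commute)
    moreover have "(- x) ^ (n - j) = (-9) ^ (n - j) * (x / 9) ^ (n - j)"
      by (simp flip: power_mult_distrib)
    moreover have "(x / 9) ^ n = (x / 9) ^ j * (x / 9) ^ (n - j)"
      using j by (simp flip: power_add)
    ultimately show "of_nat (((2 * j) choose j) * honeycomb j * ((2 * j + (n - j)) choose (n - j)))
        * (x / 9) ^ j * (- x) ^ (n - j)
      = of_nat ((2 * j) choose j) * of_nat ((n + j) choose (2 * j)) * (-9) ^ (n - j) * of_nat (honeycomb j)
        * (x / 9) ^ n"
      by (simp only: of_nat_mult ac_simps)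
  qed
  finally show ?thesis unfolding D_def .
qed

end

theorem theorem2p7:
  fixes p :: nat and x :: rat
  assumes "prime p" and "p > 3"
    and "x \<in> zp p"
    and "\<not> zp_cong p x 0" and "\<not> zp_cong p x (- 1)" and "\<not> zp_cong p x (- 1 / 3)"
    and "zp_Legendre (9 * x ^ 2 + 14 * x + 9) p = 1"
  shows "zp_cong p
    (\<Sum>k=0..p - 1. of_nat ((2 * k) choose k) * (x / (9 * x ^ 2 + 14 * x + 9)) ^ k
        * of_nat (franel k))
    (\<Sum>k=0..p - 1. of_nat (((2 * k) choose k) ^ 2 * ((4 * k) choose (2 * k)))
        * (x / (9 * (1 + 3 * x) ^ 4)) ^ k)"
proof -
  note p = assms(1)
  have "\<not> p dvd 3" using assms(2) by (auto dest: dvd_imp_le)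
  then have third: "1 / 3 \<in> zp p"
    using zp_inverse[OF p _ not_zp_cong_of_nat_0[OF p, of 3]] p by (simp add: inverse_eq_divide)
  have unit: "\<not> zp_cong p (1 + 3 * x) 0"
  proof
    assume "zp_cong p (1 + 3 * x) 0"
    then have "zp_cong p ((1 + 3 * x) * (1 / 3) + - 1 / 3) (0 * (1 / 3) + - 1 / 3)"
      using third p zp_minus[OF p third] by (intro zp_cong_add[OF p] zp_cong_mult[OF p]) simp_all
    then show False using assms(6) by (simp add: field_simps)
  qed
  show ?thesis
    unfolding atLeast0AtMost
    using zp_cong_franel_series[OF p assms(2,3,7)]
      zp_cong_sym[OF p zp_cong_quartic_series[OF p assms(2,3) unit]]
      zp_cong_trans[OF p]
    unfolding honeycomb_sum_eq_almkvist_zudilin by blast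
qed

end
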